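(* Let $p$ be a prime, and let $k>1$, $m>2$ and $\lambda\ge 1$ be integers. Then there does not exist a $(p^2,m,k,\lambda)$-SEDF over a cyclic group of order $p^2$.
   Context: Let $G$ be a finite abelian group of order $n$, written multiplicatively, with identity $e$. For nonempty subsets $A_1,A_2\subseteq G$, let $\Delta_E(A_1,A_2)$ be the multiset $\{xy^{-1} : x\in A_1,\ y\in A_2\}$. Let $k,\lambda,m$ be positive integers. An $(n,m,k,\lambda)$-strong external difference family (SEDF) over $G$ is a collection $\{A_1,\dots,A_m\}$ of pairwise disjoint $k$-element subsets of $G$ such that for each $1\le j\le m$ the multiset union $\bigcup_{\ell\neq j}\Delta_E(A_\ell,A_j)$ equals $\lambda(G\setminus\{e\})$, i.e. contains every non-identity element of $G$ exactly $\lambda$ times and does not contain $e$. *)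

theory Defs
  imports
    "HOL-Computational_Algebra.Primes"
    "HOL-Library.Multiset"
    "HOL-Library.Disjoint_Sets"
    "HOL-Algebra.Elementary_Groups"
begin

definition external_diff :: "('a, 'b) monoid_scheme \<Rightarrow> 'a set \<Rightarrow> 'a set \<Rightarrow> 'a multiset" where
  "external_diff G X Y =
     image_mset (\<lambda>(x, y). x \<otimes>\<^bsub>G\<^esub> inv\<^bsub>G\<^esub> y) (mset_set (X \<times> Y))"

(* The collection is indexed by {1..m}; values of A outside {1..m} are irrelevant.
   Since 0 < k, the blocks are nonempty, so disjointness makes them distinct. *)
definition SEDF ::
  "('a, 'b) monoid_scheme \<Rightarrow> nat \<Rightarrow> nat \<Rightarrow> nat \<Rightarrow> nat \<Rightarrow> (nat \<Rightarrow> 'a set) \<Rightarrow> bool" where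
  "SEDF G n m k l A \<longleftrightarrow>
     comm_group G \<and> finite (carrier G) \<and> Coset.order G = n \<and>
     0 < m \<and> 0 < k \<and> 0 < l \<and>
     (\<forall>j\<in>{1..m}. A j \<subseteq> carrier G \<and> card (A j) = k) \<and>
     disjoint_family_on A {1..m} \<and>
     (\<forall>j\<in>{1..m}. (\<Sum>i\<in>{1..m} - {j}. external_diff G (A i) (A j)) =
        repeat_mset l (mset_set (carrier G - {\<one>\<^bsub>G\<^esub>})))"

end

theory Submission
  imports
    Defs
    Complex_Main
    "HOL-Algebra.Multiplicative_Group"
    "HOL-Computational_Algebra.Field_as_Ring"
    "Subresultants.Subresultant_Gcd"
begin

text \<open>
  Let \<open>D\<close> be the union of the blocks. For a nontrivial character \<open>\<chi>\<close> the SEDF equation reads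
  \<open>(\<chi>(D) - \<chi>(A\<^sub>j)) cnj \<chi>(A\<^sub>j) = - \<lambda>\<close>. If \<open>\<chi>(D) \<noteq> 0\<close>, the ratios \<open>\<alpha>\<^sub>j = \<chi>(A\<^sub>j) / \<chi>(D)\<close> are therefore real,
  satisfy \<open>\<alpha>\<^sub>j\<^sup>2 - \<alpha>\<^sub>j = \<lambda> / \<bar>\<chi>(D)\<bar>\<^sup>2 > 0\<close> and sum to 1, and \<open>m > 2\<close> forces them to be rational, so that
  \<open>A\<^sub>j - \<alpha>\<^sub>j D\<close> is a rational combination annihilated by \<open>\<chi>\<close>. Irreducibility of the cyclotomic
  polynomials of prime power order turns this into constancy on cosets. For \<open>\<chi>\<close> of order \<open>p\<^sup>2\<close> the
  cosets are those of the subgroup \<open>P\<close> of order \<open>p\<close>; as \<open>\<alpha>\<^sub>j \<notin> {0, 1}\<close>, \<open>A\<^sub>j\<close> would be a union of them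
  and \<open>\<chi>(A\<^sub>j) = 0\<close>, a contradiction. Hence \<open>\<chi>(D) = 0\<close> and \<open>D\<close> is a union of \<open>P\<close>-cosets. It is not all
  of the group, by counting, so some \<open>P\<close>-coset misses every block. For \<open>\<chi>\<close> of order \<open>p\<close> this yields
  \<open>\<bar>A\<^sub>j \<inter> C\<bar> = \<alpha>\<^sub>j \<bar>D \<inter> C\<bar>\<close> for every \<open>P\<close>-coset \<open>C\<close>, so \<open>\<alpha>\<^sub>j = 1 / m\<close>, contradicting \<open>\<alpha>\<^sub>j\<^sup>2 > \<alpha>\<^sub>j\<close>.
\<close>

section \<open>Cyclotomic polynomials of prime power order\<close>

text \<open>The resultant is the same over the integers and over the complex numbers, and it
  vanishes exactly when the gcd is nonconstant. This takes the place of a minimal polynomial of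
  \<open>z\<close>.\<close>

lemma poly_of_int_common_root_imp_gcd:
  fixes f g :: "int poly" and z :: complex
  assumes "poly (of_int_poly f) z = 0" "poly (of_int_poly g) z = 0" "f \<noteq> 0"
  shows "degree (gcd f g) \<noteq> 0"
proof -
  let ?f = "of_int_poly f :: complex poly" and ?g = "of_int_poly g :: complex poly"
  have "[:- z, 1:] dvd gcd ?f ?g"
    using assms(1,2) by (simp add: poly_eq_0_iff_dvd)
  moreover have "gcd ?f ?g \<noteq> 0"
    using assms(3) by simp
  ultimately have "degree (gcd ?f ?g) \<noteq> 0"
    using dvd_imp_degree_le[of "[:- z, 1:]" "gcd ?f ?g"] by simp
  then have "resultant ?f ?g = 0"
    using resultant_0_gcd by blast
  then have "resultant f g = 0"
    by (simp add: of_int_hom.resultant_hom)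
  then show ?thesis
    using resultant_0_gcd by blast
qed

section \<open>Eisenstein's criterion\<close>

text \<open>At the least index where \<open>p\<close> does not divide the coefficient of
  \<open>h\<close>, the product has that coefficient times \<open>coeff q 0\<close> modulo
  \<open>p\<close>, which is nonzero; so this index is at least \<open>N\<close>.\<close>

lemma eisenstein_degree_le:
  fixes h q :: "int poly" and p :: int
  assumes p: "prime p" and h0: "p dvd coeff h 0" and q0: "\<not> p dvd coeff q 0"
    and lead: "\<not> p dvd lead_coeff h" and low: "\<And>i. i < N \<Longrightarrow> p dvd coeff (h * q) i"
  shows "N \<le> degree h"
proof -
  define i where "i = (LEAST i. \<not> p dvd coeff h i)"
  have i: "\<not> p dvd coeff h i" and min: "\<And>j. j < i \<Longrightarrow> p dvd coeff h j"
    using LeastI[of "\<lambda>i. \<not> p dvd coeff h i", OF lead] not_less_Least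
    unfolding i_def by blast+
  have "coeff (h * q) i = (\<Sum>j<i. coeff h j * coeff q (i - j)) + coeff h i * coeff q 0"
    by (simp add: coeff_mult lessThan_Suc_atMost[symmetric])
  moreover have "p dvd (\<Sum>j<i. coeff h j * coeff q (i - j))"
    using min by (intro dvd_sum) auto
  moreover have "\<not> p dvd coeff h i * coeff q 0"
    using p i q0 by (simp add: prime_dvd_mult_iff)
  ultimately have "\<not> p dvd coeff (h * q) i"
    by (simp add: dvd_add_right_iff)
  then have "N \<le> i" using low not_le by blast
  moreover have "i \<le> degree h"
    using i by (metis dvd_0_right le_degree)
  ultimately show ?thesis by simp
qed

text \<open>Exactly one factor has constant term divisible by \<open>p\<close>, and
  \<open>eisenstein_degree_le\<close> gives that factor the full degree.\<close>

lemma eisenstein: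
  fixes h q :: "int poly" and p :: int
  assumes p: "prime p" and lead: "\<not> p dvd lead_coeff (h * q)"
    and low: "\<And>i. i < degree (h * q) \<Longrightarrow> p dvd coeff (h * q) i"
    and c0: "\<not> p\<^sup>2 dvd coeff (h * q) 0"
  shows "degree h = 0 \<or> degree q = 0"
proof (cases "degree (h * q) = 0")
  case True
  have "h * q \<noteq> 0" using lead by auto
  then show ?thesis using True by (simp add: degree_mult_eq)
next
  case False
  have deg: "degree (h * q) = degree h + degree q"
    using lead by (intro degree_mult_eq) auto
  have lh: "\<not> p dvd lead_coeff h" "\<not> p dvd lead_coeff q"
    using lead by (auto simp: lead_coeff_mult)
  have c: "coeff (h * q) 0 = coeff h 0 * coeff q 0"
    by (simp add: coeff_mult)
  then have "p dvd coeff h 0 \<or> p dvd coeff q 0"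
    using low[of 0] False p by (simp add: prime_dvd_mult_iff)
  moreover have "\<not> (p dvd coeff h 0 \<and> p dvd coeff q 0)"
    using c0 unfolding c power2_eq_square by (blast intro: mult_dvd_mono)
  ultimately show ?thesis
    using eisenstein_degree_le[of p h q "degree (h * q)"] 
      eisenstein_degree_le[of p q h "degree (h * q)"] p lh low deg
    by (auto simp: mult.commute)
qed

section \<open>Powers of sums modulo p and irreducibility of cyclotomic polynomials\<close>

lemma prime_dvd_freshmans_dream:
  fixes x y :: "'a :: comm_ring_1"
  assumes p: "prime p"
  shows "of_nat p dvd (x + y) ^ p - (x ^ p + y ^ p)"
proof -
  have "{..p} = insert 0 (insert p {0<..<p})" using prime_gt_0_nat[OF p] by auto
  then have "(x + y) ^ p - (x ^ p + y ^ p)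
      = (\<Sum>k\<in>{0<..<p}. of_nat (p choose k) * x ^ k * y ^ (p - k))"
    using prime_gt_0_nat[OF p] unfolding binomial_ring by simp
  moreover have "of_nat p dvd \<dots>"
  proof (rule dvd_sum)
    fix k assume "k \<in> {0<..<p}"
    then have "p dvd (p choose k)"
      using p by (intro dvd_choose_prime) auto
    then have "of_nat p dvd (of_nat (p choose k) :: 'a)"
      unfolding dvd_def by (metis of_nat_mult)
    then show "of_nat p dvd of_nat (p choose k) * x ^ k * y ^ (p - k)"
      by (simp add: mult.assoc)
  qed
  ultimately show ?thesis by simp
qed

lemma diff_add_cancel_middle: "(x - y) + (y - z) = x - (z :: 'a :: ab_group_add)"
  by simp

text \<open>Since \<open>u - v\<close> divides \<open>u ^ p - v ^ p\<close>, a congruence modulo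
  \<open>p\<close> survives raising to the power \<open>p\<close>; this drives the
  induction.\<close>

lemma prime_dvd_freshmans_dream_power:
  fixes x y :: "'a :: comm_ring_1"
  assumes p: "prime p"
  shows "of_nat p dvd (x + y) ^ (p ^ a) - (x ^ (p ^ a) + y ^ (p ^ a))"
proof (induction a)
  case (Suc a)
  let ?q = "p ^ a"
  have "((x + y) ^ ?q - (x ^ ?q + y ^ ?q)) dvd ((x + y) ^ ?q) ^ p - (x ^ ?q + y ^ ?q) ^ p"
    by (simp only: power_diff_sumr2 dvd_triv_left)
  then have 1: "of_nat p dvd ((x + y) ^ ?q) ^ p - (x ^ ?q + y ^ ?q) ^ p"
    using Suc dvd_trans by blast
  have 2: "of_nat p dvd (x ^ ?q + y ^ ?q) ^ p - ((x ^ ?q) ^ p + (y ^ ?q) ^ p)"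
    by (rule prime_dvd_freshmans_dream[OF p])
  show ?case
    using dvd_add[OF 1 2] unfolding diff_add_cancel_middle
    by (simp only: power_mult[symmetric] power_Suc2)
qed simp

text \<open>For \<open>r\<close> a power of \<open>p\<close> this is the cyclotomic polynomial of order \<open>p * r\<close>.\<close>

definition cyclo :: "nat \<Rightarrow> nat \<Rightarrow> int poly" where
  "cyclo p r = (\<Sum>j<p. monom 1 (r * j))"

lemma coeff_cyclo:
  assumes "r > 0"
  shows "coeff (cyclo p r) i = (if r dvd i \<and> i < r * p then 1 else 0)"
proof -
  have "coeff (cyclo p r) i = (\<Sum>j<p. if r * j = i then 1 else 0)"
    by (simp add: cyclo_def coeff_sum)
  also have "\<dots> = (\<Sum>j\<in>(if r dvd i \<and> i < r * p then {i div r} else {}). 1)"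
    using assms by (intro sum.mono_neutral_cong_right) (auto split: if_splits)
  finally show ?thesis by simp
qed

lemma degree_cyclo:
  assumes "r > 0" "p > 0"
  shows "degree (cyclo p r) = r * (p - 1)"
proof (rule antisym)
  show "degree (cyclo p r) \<le> r * (p - 1)"
    using assms by (intro degree_le) (auto simp: coeff_cyclo elim!: dvdE)
  show "r * (p - 1) \<le> degree (cyclo p r)"
    using assms by (intro le_degree) (auto simp: coeff_cyclo)
qed

lemma cyclo_mult: "cyclo p r * (monom 1 r - 1) = monom 1 (r * p) - 1"
proof -
  have "cyclo p r = (\<Sum>j<p. monom 1 r ^ j)"
    by (simp add: cyclo_def monom_power mult.commute)
  then show ?thesis
    using power_diff_1_eq[of "monom (1::int) r" p] by (simp add: monom_power mult.commute)
qed

lemma monom_1_pcompose: "monom 1 n \<circ>\<^sub>p q = (q :: 'a :: comm_ring_1 poly) ^ n"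
  by (induction n) (simp_all add: monom_Suc pcompose_pCons monom_0 pcompose_1)

lemma monom_pcompose_shift: "monom 1 n \<circ>\<^sub>p pCons 1 1 = (monom 1 (Suc 0) + 1 :: int poly) ^ n"
proof -
  have "pCons 1 1 = (monom 1 (Suc 0) + 1 :: int poly)"
    by (rule poly_eqI) (simp add: coeff_pCons split: nat.split)
  then show ?thesis by (simp only: monom_1_pcompose)
qed

text \<open>Substituting \<open>X + 1\<close> in \<open>cyclo_mult\<close> and reducing modulo
  \<open>p\<close> leaves \<open>X ^ r * Q = X ^ (r * p)\<close>, so \<open>Q\<close> is congruent
  to \<open>X ^ (r * (p - 1))\<close>.\<close>

lemma cyclo_shift_coeff:
  assumes p: "prime p" and r: "r = p ^ a" and i: "i < r * (p - 1)"
  shows "int p dvd coeff (cyclo p r \<circ>\<^sub>p [:1, 1:]) i"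
proof -
  let ?Q = "cyclo p r \<circ>\<^sub>p [:1, 1:]" and ?X = "monom 1 1 :: int poly"
  have "?Q * ((?X + 1) ^ r - 1) = (?X + 1) ^ (r * p) - 1"
    using arg_cong[OF cyclo_mult[of p r], of "\<lambda>f. f \<circ>\<^sub>p [:1, 1:]"]
    by (simp add: pcompose_mult pcompose_diff monom_pcompose_shift)
  moreover obtain U where U: "(?X + 1) ^ r - (?X ^ r + 1) = of_nat p * U"
    using prime_dvd_freshmans_dream_power[OF p, of ?X 1 a] r by (auto elim!: dvdE)
  moreover obtain V where V: "(?X + 1) ^ (r * p) - (?X ^ (r * p) + 1) = of_nat p * V"
    using prime_dvd_freshmans_dream_power[OF p, of ?X 1 "Suc a"] r
    by (auto elim!: dvdE simp: mult.commute[of _ p])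
  ultimately have "?Q * (?X ^ r + of_nat p * U) = ?X ^ (r * p) + of_nat p * V"
    by (simp add: algebra_simps)
  then have "monom 1 r * ?Q = monom 1 (r * p) + smult (int p) (V - ?Q * U)"
    by (simp add: monom_power algebra_simps of_nat_poly smult_diff_right)
  then have "coeff (monom 1 r * ?Q) (i + r) = int p * coeff (V - ?Q * U) (i + r)"
    using i by (simp add: coeff_monom diff_mult_distrib2)
  then show ?thesis by (simp add: coeff_monom_mult)
qed

text \<open>Eisenstein applies after the shift by 1: the polynomial stays monic, and its constant
  term becomes its value \<open>p\<close> at 1.\<close>

lemma cyclo_factor:
  assumes p: "prime p" and r: "r = p ^ a" and hq: "cyclo p r = h * q"
  shows "degree h = 0 \<or> degree q = 0"
proof -
  have pos: "p > 0" "r > 0" using p r by (auto simp: prime_gt_0_nat)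
  let ?s = "[:1, 1:] :: int poly"
  have eq: "cyclo p r \<circ>\<^sub>p ?s = (h \<circ>\<^sub>p ?s) * (q \<circ>\<^sub>p ?s)"
    by (simp add: hq pcompose_mult)
  have deg: "degree (cyclo p r \<circ>\<^sub>p ?s) = r * (p - 1)"
    using pos by (simp add: degree_pcompose degree_cyclo)
  have lead: "lead_coeff (cyclo p r \<circ>\<^sub>p ?s) = 1"
    using pos by (subst lead_coeff_comp) (auto simp: degree_cyclo coeff_cyclo)
  have "coeff (cyclo p r \<circ>\<^sub>p ?s) 0 = poly (cyclo p r) 1"
    by (simp add: poly_0_coeff_0[symmetric] poly_pcompose)
  then have c0: "coeff (cyclo p r \<circ>\<^sub>p ?s) 0 = int p"
    by (simp add: cyclo_def poly_sum poly_monom)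
  have "degree (h \<circ>\<^sub>p ?s) = 0 \<or> degree (q \<circ>\<^sub>p ?s) = 0"
  proof (rule eisenstein[of "int p"])
    show "\<not> int p dvd lead_coeff (h \<circ>\<^sub>p ?s * q \<circ>\<^sub>p ?s)"
      using lead prime_gt_1_nat[OF p] unfolding eq by simp
    show "\<not> (int p)\<^sup>2 dvd coeff (h \<circ>\<^sub>p ?s * q \<circ>\<^sub>p ?s) 0"
      using c0 prime_gt_1_nat[OF p] unfolding eq[symmetric] power2_eq_square
      by auto
    show "int p dvd coeff (h \<circ>\<^sub>p ?s * q \<circ>\<^sub>p ?s) i" if "i < degree (h \<circ>\<^sub>p ?s * q \<circ>\<^sub>p ?s)" for i
      using that deg cyclo_shift_coeff[OF p r] unfolding eq[symmetric] by simp
  qed (use p in simp)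
  then show ?thesis by (simp add: degree_pcompose)
qed

lemma geometric_sum_root_of_unity:
  fixes z :: "'a :: idom"
  assumes "z ^ n = 1" "z \<noteq> 1"
  shows "(\<Sum>i<n. z ^ i) = 0"
  using power_diff_1_eq[of z n] assms by simp

section \<open>Vanishing sums of roots of unity\<close>

lemma cyclo_root:
  fixes z :: complex
  assumes "z ^ (r * p) = 1" "z ^ r \<noteq> 1"
  shows "poly (of_int_poly (cyclo p r)) z = 0"
proof -
  have "poly (of_int_poly (cyclo p r)) z = (\<Sum>j<p. (z ^ r) ^ j)"
    by (simp add: cyclo_def of_int_poly_hom.hom_sum poly_sum poly_monom power_mult)
  also have "\<dots> = 0"
    using assms by (intro geometric_sum_root_of_unity) (simp_all add: power_mult)
  finally show ?thesis .
qed

text \<open>The gcd with \<open>f\<close> is nonconstant because of the common root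
  \<open>z\<close>, so its cofactor is constant, and a unit because \<open>cyclo p r\<close> is
  monic.\<close>

lemma cyclo_dvd:
  fixes z :: complex and f :: "int poly"
  assumes p: "prime p" and r: "r = p ^ a" and z: "z ^ (r * p) = 1" "z ^ r \<noteq> 1"
    and f: "poly (of_int_poly f) z = 0"
  shows "cyclo p r dvd f"
proof -
  have pos: "p > 0" "r > 0" using p r by (auto simp: prime_gt_0_nat)
  have nz: "cyclo p r \<noteq> 0"
    using coeff_cyclo[OF pos(2), of p 0] pos by auto
  obtain q where q: "cyclo p r = gcd (cyclo p r) f * q"
    using gcd_dvd1 by (rule dvdE)
  have "degree q = 0"
    using cyclo_factor[OF p r q] poly_of_int_common_root_imp_gcd[OF cyclo_root[OF z] f nz] by simp
  then obtain c where c: "q = [:c:]" by (rule degree_eq_zeroE)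
  have "1 = lead_coeff (cyclo p r)" using pos by (simp add: degree_cyclo coeff_cyclo)
  also have "\<dots> = lead_coeff (gcd (cyclo p r) f) * c" 
    using arg_cong[OF q, of lead_coeff] c by (simp add: lead_coeff_mult)
  finally have "is_unit c" by (metis dvd_triv_right)
  then have "is_unit q" using c by simp
  then have "cyclo p r dvd gcd (cyclo p r) f"
    using q by (metis dvd_refl mult_unit_dvd_iff)
  then show ?thesis by simp
qed

text \<open>By the degree bound the cofactor of the cyclotomic polynomial has degree below \<open>r\<close>,
  so the product just repeats its coefficients with period \<open>r\<close>.\<close>

lemma vanishing_sum_periodic:
  fixes z :: complex and h :: "nat \<Rightarrow> int"
  assumes p: "prime p" and r: "r = p ^ a" and z: "z ^ (r * p) = 1" "z ^ r \<noteq> 1"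
    and sum: "(\<Sum>i<r * p. of_int (h i) * z ^ i) = 0"
    and i: "i < r * p"
  shows "h i = h (i mod r)"
proof -
  have pos: "p > 0" "r > 0" using p r by (auto simp: prime_gt_0_nat)
  define f where "f = (\<Sum>i<r * p. monom (h i) i)"
  have cf: "coeff f j = (if j < r * p then h j else 0)" for j
    by (simp add: f_def coeff_sum)
  have "poly (of_int_poly f) z = 0"
    using sum by (simp add: f_def of_int_poly_hom.hom_sum poly_sum poly_monom)
  from cyclo_dvd[OF p r z this] obtain q where q: "f = cyclo p r * q" by (rule dvdE)
  have dq: "coeff q j = 0" if "j \<ge> r" for j
  proof (rule ccontr)
    assume "coeff q j \<noteq> 0"
    then have q0: "q \<noteq> 0" "r \<le> degree q" using that le_degree[of q j] by auto
    have nz: "cyclo p r \<noteq> 0"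
      using coeff_cyclo[OF pos(2), of p 0] pos by auto
    have "degree f \<ge> r * p"
      using q0 nz pos unfolding q
      by (subst degree_mult_eq) (auto simp: degree_cyclo diff_mult_distrib2)
    then have "coeff f (degree f) = 0" by (simp add: cf)
    then show False using q q0 nz by simp
  qed
  have c: "coeff f j = coeff q (j mod r)" if "j < r * p" for j
  proof -
    have "coeff f j = (\<Sum>t\<le>j. coeff (cyclo p r) (j - t) * coeff q t)"
      unfolding q by (subst mult.commute) (simp add: coeff_mult mult.commute)
    also have "\<dots> = (\<Sum>t\<in>{j mod r}. coeff q t)"
    proof (rule sum.mono_neutral_cong_right)
      \<comment> \<open>Below \<open>r\<close> only \<open>t = j mod r\<close> makes
        \<open>j - t\<close> a multiple of \<open>r\<close>; from \<open>r\<close> on the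
        coefficients of \<open>q\<close> vanish.\<close>
      show "\<forall>t\<in>{..j} - {j mod r}. coeff (cyclo p r) (j - t) * coeff q t = 0"
      proof
        fix t assume t: "t \<in> {..j} - {j mod r}"
        show "coeff (cyclo p r) (j - t) * coeff q t = 0"
        proof (cases "t < r")
          case True
          then have "\<not> r dvd j - t"
            using t by (auto simp: mod_eq_dvd_iff_nat[symmetric])
          then show ?thesis using pos by (simp add: coeff_cyclo)
        qed (use dq in simp)
      qed
      show "coeff (cyclo p r) (j - t) * coeff q t = coeff q t" if "t \<in> {j mod r}" for t
      proof -
        have "j - t < r * p" using \<open>j < r * p\<close> by simp
        moreover have "r dvd j - t" using that by (simp add: minus_mod_eq_mult_div)
        ultimately show ?thesis using pos by (simp add: coeff_cyclo)
      qed
    qed auto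
    finally show ?thesis by simp
  qed
  have "i mod r < r * p"
    using i by (meson le_less_trans mod_less_eq_dividend)
  then show ?thesis using c[OF i] c[of "i mod r"] cf i by simp
qed

section \<open>Character sums of the blocks\<close>

text \<open>The ratios \<open>z j / D\<close> are real roots of \<open>x\<^sup>2 - x = \<mu> / \<bar>D\<bar>\<^sup>2\<close> summing to 1. Since there are
  \<open>m \<noteq> 2\<close> of them, this makes the square root of the discriminant rational.\<close>

lemma block_sums_rational_multiples:
  fixes z :: "'i \<Rightarrow> complex" and \<mu> :: real
  assumes J: "finite J" "card J > 2" and \<mu>: "\<mu> > 0" and D: "(\<Sum>i\<in>J. z i) = D" "D \<noteq> 0"
    and eq: "\<And>j. j \<in> J \<Longrightarrow> (D - z j) * cnj (z j) = - of_real \<mu>"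
  obtains a :: "'i \<Rightarrow> int" and b :: int where "b \<noteq> 0"
    and "\<And>j. j \<in> J \<Longrightarrow> of_int b * z j = of_int (a j) * D"
    and "\<And>j. j \<in> J \<Longrightarrow> a j * (a j - b) > 0"
proof -
  define N where "N = (cmod D)\<^sup>2"
  have N: "N > 0" using D by (simp add: N_def)
  \<comment> \<open>By \<open>eq\<close>, \<open>D * cnj (z j)\<close> is the real number in the
    numerator; hence this is the ratio \<open>z j / D\<close>.\<close>
  define \<alpha> where "\<alpha> j = ((cmod (z j))\<^sup>2 - \<mu>) / N" for j
  have z\<alpha>: "z j = of_real (\<alpha> j) * D" if "j \<in> J" for j
  proof -
    have "D * cnj (z j) = of_real ((cmod (z j))\<^sup>2 - \<mu>)"
      using eq[OF that] by (simp add: left_diff_distrib flip: complex_norm_square) (simp add: algebra_simps)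
    then have "cnj (D * cnj (z j)) = of_real ((cmod (z j))\<^sup>2 - \<mu>)"
      by (metis complex_cnj_complex_of_real)
    then have "D * (cnj D * z j) = of_real ((cmod (z j))\<^sup>2 - \<mu>) * D"
      by (simp add: mult.commute)
    then have "of_real N * z j = of_real ((cmod (z j))\<^sup>2 - \<mu>) * D"
      unfolding N_def by (simp only: complex_norm_square mult.assoc)
    then show ?thesis using N by (simp add: \<alpha>_def field_simps)
  qed
  have quad: "(\<alpha> j)\<^sup>2 - \<alpha> j = \<mu> / N" if "j \<in> J" for j
  proof -
    have "(cmod (z j))\<^sup>2 = (\<alpha> j)\<^sup>2 * N"
      by (simp add: z\<alpha>[OF that] norm_mult power_mult_distrib N_def)
    then have "\<alpha> j * N = (\<alpha> j)\<^sup>2 * N - \<mu>"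
      using N by (simp add: \<alpha>_def)
    then show ?thesis using N by (simp add: field_simps)
  qed
  \<comment> \<open>The roots of the quadratic are (1 + s) / 2 and (1 - s) / 2;
    \<open>\<sigma> j\<close> records which one \<open>\<alpha> j\<close> is.\<close>
  define s where "s = sqrt (1 + 4 * (\<mu> / N))"
  define \<sigma> :: "'i \<Rightarrow> int" where "\<sigma> j = (if 2 * \<alpha> j - 1 \<ge> 0 then 1 else - 1)" for j
  have \<alpha>\<sigma>: "2 * \<alpha> j - 1 = of_int (\<sigma> j) * s" if "j \<in> J" for j
  proof -
    have "(2 * \<alpha> j - 1)\<^sup>2 = 1 + 4 * (\<mu> / N)"
      unfolding quad[OF that, symmetric] by (simp add: power2_eq_square algebra_simps)
    then have "s = \<bar>2 * \<alpha> j - 1\<bar>"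
      unfolding s_def by (metis real_sqrt_abs)
    then show ?thesis by (auto simp: \<sigma>_def)
  qed
  have "of_real (\<Sum>j\<in>J. \<alpha> j) * D = D"
    using D(1) z\<alpha> by (simp add: sum_distrib_right)
  then have "(\<Sum>j\<in>J. \<alpha> j) = 1"
    using D(2) by (metis mult_cancel_right2 of_real_eq_1_iff)
  moreover have "(\<Sum>j\<in>J. 2 * \<alpha> j - 1) = 2 * (\<Sum>j\<in>J. \<alpha> j) - real (card J)"
    by (simp add: sum_subtractf sum_distrib_left)
  moreover have "(\<Sum>j\<in>J. 2 * \<alpha> j - 1) = of_int (\<Sum>j\<in>J. \<sigma> j) * s"
    using \<alpha>\<sigma> by (simp add: sum_distrib_right)
  moreover define t where "t = (\<Sum>j\<in>J. \<sigma> j)"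
  ultimately have ts: "of_int t * s = 2 - real (card J)" by simp
  have t0: "t \<noteq> 0" using ts J by auto
  \<comment> \<open>This is \<open>2 * t * \<alpha> j = t + \<sigma> j * (t * s)\<close> with the
    integer value of \<open>t * s\<close> inserted.\<close>
  define a where "a j = t + \<sigma> j * (2 - int (card J))" for j
  have a\<alpha>: "real_of_int (a j) = of_int (2 * t) * \<alpha> j" if "j \<in> J" for j
  proof -
    have "real_of_int (a j) = of_int t + of_int (\<sigma> j) * (of_int t * s)"
      by (simp add: a_def ts)
    also have "\<dots> = of_int t * (1 + (2 * \<alpha> j - 1))"
      using \<alpha>\<sigma>[OF that] by (simp add: algebra_simps)
    finally show ?thesis by simp
  qed
  show ?thesis
  proof
    show "2 * t \<noteq> 0" using t0 by simp
    show "of_int (2 * t) * z j = of_int (a j) * D" if "j \<in> J" for j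
      using arg_cong[OF a\<alpha>[OF that], of complex_of_real] by (simp add: z\<alpha>[OF that])
    show "a j * (a j - 2 * t) > 0" if "j \<in> J" for j
    proof -
      have "real_of_int (a j * (a j - 2 * t)) = (of_int (2 * t))\<^sup>2 * ((\<alpha> j)\<^sup>2 - \<alpha> j)"
        by (simp add: a\<alpha>[OF that] power2_eq_square algebra_simps)
      also have "\<dots> > 0" using quad[OF that] \<mu> N t0 by simp
      finally show ?thesis by (simp only: of_int_0_less_iff)
    qed
  qed
qed

section \<open>Residue classes of exponents and counting\<close>

lemma sum_residues:
  fixes f :: "nat \<Rightarrow> 'a :: comm_monoid_add"
  shows "(\<Sum>i<r * p. f i) = (\<Sum>c<r. \<Sum>d<p. f (c + r * d))"
proof -
  have "(\<Sum>i<r * p. f i) = (\<Sum>d<p. \<Sum>i\<in>{d * r..<d * r + r}. f i)"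
    by (simp add: sum.nat_group mult.commute)
  also have "\<dots> = (\<Sum>d<p. \<Sum>c<r. f (c + r * d))"
  proof (rule sum.cong[OF refl])
    fix d
    show "(\<Sum>i\<in>{d * r..<d * r + r}. f i) = (\<Sum>c<r. f (c + r * d))"
      by (rule sum.reindex_bij_witness[of _ "\<lambda>c. c + r * d" "\<lambda>i. i - r * d"])
        (auto simp: mult.commute)
  qed
  finally show ?thesis by (subst sum.swap)
qed

text \<open>Converse of \<open>vanishing_sum_periodic\<close>: every class modulo \<open>r\<close>
  contributes a multiple of the sum of all powers of \<open>z ^ r\<close>, a nontrivial
  \<open>p\<close>-th root of unity.\<close>

lemma periodic_sum_vanishes:
  fixes z :: complex
  assumes "z ^ (r * p) = 1" "z ^ r \<noteq> 1"
  shows "(\<Sum>i<r * p. f (i mod r) * z ^ i) = 0"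
proof -
  have *: "(\<Sum>d<p. (z ^ r) ^ d) = 0"
    using assms by (intro geometric_sum_root_of_unity) (simp_all add: power_mult)
  have "(\<Sum>i<r * p. f (i mod r) * z ^ i) = (\<Sum>c<r. f c * z ^ c * (\<Sum>d<p. (z ^ r) ^ d))"
    unfolding sum_residues by (simp add: power_add power_mult sum_distrib_left mult.assoc)
  then show ?thesis by (simp add: *)
qed

text \<open>The parameter equation forces \<open>k\<^sup>2\<close> to divide \<open>l\<close> as soon as \<open>k\<close> divides \<open>n\<close>.\<close>

lemma blocks_not_partition:
  fixes m k l n :: int
  assumes "k > 1" "m > 2" "l > 0" and eq: "(m * k - k) * k = l * (n - 1)"
  shows "m * k \<noteq> n"
proof
  assume n: "m * k = n"
  have "coprime k (n - 1)"
    unfolding n[symmetric] by (rule coprimeI) (metis dvd_diff_right_iff dvd_mult2 mult.commute)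
  then have "coprime (k\<^sup>2) (n - 1)" by simp
  moreover have "k\<^sup>2 dvd l * (n - 1)"
    unfolding eq[symmetric] by (rule dvdI[of _ _ "m - 1"]) (simp add: power2_eq_square algebra_simps)
  ultimately have "k\<^sup>2 dvd l" by (simp add: coprime_dvd_mult_left_iff)
  then have "k\<^sup>2 \<le> l" using assms by (simp add: zdvd_imp_le)
  moreover have "n - 1 > 0" using n assms by (smt (verit) mult_le_cancel_left1)
  \<comment> \<open>The parameter equation reads \<open>l * (n - 1) = k\<^sup>2 * (m - 1)\<close>,
    so \<open>k\<^sup>2 \<le> l\<close> leaves no room for \<open>n = m * k > m\<close>.\<close>
  ultimately have "k\<^sup>2 * (n - 1) \<le> k\<^sup>2 * (m - 1)"
    using mult_right_mono[of "k\<^sup>2" l "n - 1"] eq by (simp add: power2_eq_square algebra_simps)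
  then have "m * k \<le> m" using n assms by simp
  then show False using assms by (simp add: mult_le_cancel_left2)
qed

lemma root_of_unity_exists:
  assumes "0 < r" "r < n"
  obtains z :: complex where "z ^ n = 1" "z ^ r \<noteq> 1"
proof
  define z where "z = cis (2 * pi / n)"
  show "z ^ n = 1" using assms by (simp add: z_def DeMoivre)
  show "z ^ r \<noteq> 1"
  proof
    assume "z ^ r = 1"
    then have "cos (2 * pi * r / n) = 1"
      by (simp add: z_def DeMoivre complex_eq_iff mult.commute)
    then obtain i :: int where "2 * pi * r / n = of_int i * (2 * pi)"
      by (auto simp: cos_one_2pi_int mult.assoc)
    then have "real r = n * of_int i" using assms by (simp add: field_simps)
    then have "real r / n = of_int i" using assms by simp
    moreover have "0 < real r / n" "real r / n < 1" using assms by auto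
    ultimately have "0 < i" "i < 1" by simp_all
    then show False by simp
  qed
qed

text \<open>The group is replaced by exponents of a generator: \<open>u j\<close> is the indicator
  of block \<open>j\<close>, and \<open>sedf\<close> is the family equation under the character
  sending the generator to \<open>w\<close>.\<close>

lemma no_sedf_indicator:
  fixes u :: "'i \<Rightarrow> nat \<Rightarrow> int" and k l :: int
  assumes p: "prime p" and J: "finite J" "card J > 2" and "k > 1" "l > 0"
    and u: "\<And>j i. j \<in> J \<Longrightarrow> i < p * p \<Longrightarrow> u j i \<in> {0, 1}"
    and disj: "\<And>i. i < p * p \<Longrightarrow> (\<Sum>j\<in>J. u j i) \<in> {0, 1}"
    and size: "\<And>j. j \<in> J \<Longrightarrow> (\<Sum>i<p * p. u j i) = k"
    and sedf: "\<And>w :: complex. \<And>j. w ^ (p * p) = 1 \<Longrightarrow> j \<in> J \<Longrightarrow>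
      ((\<Sum>i\<in>J. \<Sum>t<p * p. of_int (u i t) * w ^ t) - (\<Sum>t<p * p. of_int (u j t) * w ^ t))
        * cnj (\<Sum>t<p * p. of_int (u j t) * w ^ t)
      = of_int l * ((\<Sum>t<p * p. w ^ t) - 1)"
  shows False
proof -
  have p1: "p > 1" using p by (rule prime_gt_1_nat)
  obtain j0 where j0: "j0 \<in> J" using J by fastforce
  define m where "m = int (card J)"
  define S where "S w j = (\<Sum>t<p * p. of_int (u j t) * w ^ t)" for w :: complex and j
  define V where "V i = (\<Sum>j\<in>J. u j i)" for i
  have V01: "V i \<in> {0, 1}" if "i < p * p" for i
    using disj[OF that] by (simp add: V_def)
  have uV: "u j i \<le> V i" if "j \<in> J" "i < p * p" for i j
    unfolding V_def using that u J by (intro member_le_sum) force+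
  have sumS: "(\<Sum>j\<in>J. S w j) = (\<Sum>t<p * p. of_int (V t) * w ^ t)" for w
    unfolding S_def V_def by (subst sum.swap) (simp add: sum_distrib_right)
  have sumV: "(\<Sum>t<p * p. V t) = m * k"
    unfolding V_def by (subst sum.swap) (simp add: size m_def)
  have S1: "S 1 j = of_int k" if "j \<in> J" for j
    using arg_cong[OF size[OF that], of "of_int :: int \<Rightarrow> complex"] by (simp add: S_def)
  \<comment> \<open>The trivial character yields the parameter equation.\<close>
  have "((\<Sum>j\<in>J. S 1 j) - S 1 j0) * cnj (S 1 j0) = of_int l * (of_nat (p * p) - 1)"
    using sedf[of 1 j0] j0 by (simp add: S_def)
  then have "of_int ((m * k - k) * k) = (of_int (l * (int (p * p) - 1)) :: complex)"
    by (simp add: S1 j0 m_def)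
  then have "(m * k - k) * k = l * (int (p * p) - 1)"
    by (simp only: of_int_eq_iff)
  then have mk: "m * k \<noteq> int (p * p)"
    using \<open>k > 1\<close> \<open>l > 0\<close> J blocks_not_partition[of k m l "int (p * p)"] by (simp add: m_def)
  have K: "((\<Sum>j\<in>J. S w j) - S w j') * cnj (S w j') = - of_real (of_int l)"
    if "w ^ (p * p) = 1" "w \<noteq> 1" "j' \<in> J" for w j'
    using sedf[OF that(1,3)] geometric_sum_root_of_unity[OF that(1,2)] by (simp add: S_def)
  have ratio: "\<exists>a b. b \<noteq> 0 \<and> (\<forall>j\<in>J. of_int b * S w j = of_int (a j) * (\<Sum>j\<in>J. S w j)
      \<and> a j * (a j - b) > 0)"
    if "w ^ (p * p) = 1" "w \<noteq> 1" "(\<Sum>j\<in>J. S w j) \<noteq> 0" for w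
    using block_sums_rational_multiples[OF J _ refl that(3) K[OF that(1,2)]] \<open>l > 0\<close>
    by (metis of_int_0_less_iff)

  text \<open>Characters of order \<open>p\<^sup>2\<close>: the union of the blocks is invariant under the subgroup of
    order \<open>p\<close>, for otherwise each block would be, and its character sum would vanish.\<close>
  obtain \<zeta> :: complex where \<zeta>: "\<zeta> ^ (p * p) = 1" "\<zeta> ^ p \<noteq> 1"
    using root_of_unity_exists[of p "p * p"] p1 by auto
  have \<zeta>1: "\<zeta> \<noteq> 1" using \<zeta>(2) by auto
  have Vper: "V i = V (i mod p)" if i: "i < p * p" for i
  proof (cases "(\<Sum>j\<in>J. S \<zeta> j) = 0")
    case True
    then show ?thesis
      using vanishing_sum_periodic[OF p power_one_right[symmetric] \<zeta> _ i, of V] sumS by simp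
  next
    case False
    obtain a b where b: "b \<noteq> 0"
      and ab: "\<And>j. j \<in> J \<Longrightarrow> of_int b * S \<zeta> j = of_int (a j) * (\<Sum>j\<in>J. S \<zeta> j)"
      and pos: "\<And>j. j \<in> J \<Longrightarrow> a j * (a j - b) > 0"
      using ratio[OF \<zeta>(1) \<zeta>1 False] by blast
    have "(\<Sum>t<p * p. of_int (b * u j0 t - a j0 * V t) * \<zeta> ^ t) = 0"
      using ab[OF j0] unfolding sumS unfolding S_def
      by (simp add: sum_subtractf left_diff_distrib sum_distrib_left mult.assoc)
    note per = vanishing_sum_periodic[OF p power_one_right[symmetric] \<zeta> this]
    \<comment> \<open>The possible pairs (\<open>u j0 t\<close>, \<open>V t\<close>) are (0,0),
      (0,1) and (1,1). They give \<open>b * u j0 t - a j0 * V t\<close> the distinct values 0,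
      \<open>- a j0\<close> and \<open>b - a j0\<close>, so periodicity of this expression passes to
      \<open>u j0\<close>.\<close>
    have "u j0 t = u j0 (t mod p)" if t: "t < p * p" for t
    proof -
      have t': "t mod p < p * p" using t by (meson le_less_trans mod_less_eq_dividend)
      have "a j0 \<noteq> 0" "a j0 \<noteq> b" using pos[OF j0] by auto
      then show ?thesis
        using per[OF t] u[OF j0 t] u[OF j0 t'] V01[OF t] V01[OF t'] uV[OF j0 t] uV[OF j0 t'] b
        by auto
    qed
    then have "S \<zeta> j0 = (\<Sum>t<p * p. of_int (u j0 (t mod p)) * \<zeta> ^ t)"
      unfolding S_def by (intro sum.cong) auto
    also have "\<dots> = 0" by (rule periodic_sum_vanishes[OF \<zeta>])
    finally show ?thesis using K[OF \<zeta>(1) \<zeta>1 j0] \<open>l > 0\<close> by simp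
  qed

  text \<open>Characters of order \<open>p\<close>: a coset avoiding all blocks makes the rational ratio an exact
    proportionality, forcing it to equal \<open>1 / m\<close>, which is not outside \<open>[0, 1]\<close>.\<close>
  define \<omega> where "\<omega> = \<zeta> ^ p"
  \<comment> \<open>The form \<open>1 * p\<close> fits \<open>vanishing_sum_periodic\<close> with
    \<open>r = 1 = p ^ 0\<close>, where periodicity means constancy.\<close>
  have \<omega>: "\<omega> ^ (1 * p) = 1" "\<omega> ^ 1 \<noteq> 1" "\<omega> ^ (p * p) = 1" "\<omega> \<noteq> 1"
    using \<zeta> by (simp_all add: \<omega>_def power_mult) 
  have bound: "c + p * d < p * p" if "c < p" "d < p" for c d
  proof -
    have "c + p * d < p * Suc d" using that by simp
    also have "\<dots> \<le> p * p" using that by (intro mult_le_mono2) simp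
    finally show ?thesis .
  qed
  have bound0: "c < p * p" if "c < p" for c
    using bound[OF that, of 0] that by simp
  \<comment> \<open>The number of elements of block \<open>j\<close> in the coset with exponents
    congruent to \<open>c\<close> modulo \<open>p\<close>.\<close>
  define h where "h j c = (\<Sum>d<p. u j (c + p * d))" for j c
  have fold_period: "(\<Sum>t<p * p. of_int (f t) * \<omega> ^ t) = (\<Sum>c<1 * p. of_int (\<Sum>d<p. f (c + p * d)) * \<omega> ^ c)"
    for f :: "nat \<Rightarrow> int"
  proof -
    have "\<omega> ^ (c + p * d) = \<omega> ^ c" for c d
      using \<omega>(1) by (simp add: power_add power_mult)
    then show ?thesis unfolding sum_residues by (simp add: sum_distrib_right)
  qed
  have H: "(\<Sum>d<p. V (c + p * d)) = int p * V c" if "c < p" for c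
  proof -
    have "V (c + p * d) = V c" if "d < p" for d
      using Vper[OF bound[OF \<open>c < p\<close> that]] \<open>c < p\<close> by simp
    then show ?thesis by simp
  qed
  have SV: "(\<Sum>j\<in>J. S \<omega> j) = (\<Sum>c<1 * p. of_int (int p * V c) * \<omega> ^ c)"
    unfolding sumS fold_period using H by (intro sum.cong) auto
  obtain c0 where c0: "c0 < p" "V c0 = 0"
  proof -
    have "\<exists>t<p * p. V t \<noteq> 1"
    proof (rule ccontr)
      assume "\<not> ?thesis"
      then have "(\<Sum>t<p * p. V t) = int (p * p)" by simp
      then show False using sumV mk by simp
    qed
    then obtain t where t: "t < p * p" "V t = 0" using V01 by blast
    then show ?thesis using that[of "t mod p"] Vper[OF t(1)] p1 by simp
  qed
  have mk0: "m * k \<noteq> 0"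
    using J(2) \<open>k > 1\<close> unfolding m_def
    by (metis mult_eq_0_iff of_nat_eq_0_iff not_less0 not_one_less_zero)
  show False
  proof (cases "(\<Sum>j\<in>J. S \<omega> j) = 0")
    case True
    have const: "V c = V 0" if "c < p" for c
    proof -
      have "int p * V c = int p * V (c mod 1)"
        using that by (intro vanishing_sum_periodic[OF p power_0[symmetric] \<omega>(1,2) True[unfolded SV]]) simp
      then show ?thesis using p1 by simp
    qed
    have "V 0 = 0" using const[OF c0(1)] c0(2) by simp
    then have "V t = 0" if "t < p * p" for t
      using Vper[OF that] const[of "t mod p"] p1 by simp
    then show False using sumV mk0 by simp
  next
    case False
    obtain a b where b: "b \<noteq> 0"
      and ab: "\<And>j. j \<in> J \<Longrightarrow> of_int b * S \<omega> j = of_int (a j) * (\<Sum>j\<in>J. S \<omega> j)"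
      and pos: "\<And>j. j \<in> J \<Longrightarrow> a j * (a j - b) > 0"
      using ratio[OF \<omega>(3,4) False] by blast
    \<comment> \<open>Being annihilated by \<open>\<omega>\<close>, \<open>f\<close> is constant; at
      the empty coset \<open>c0\<close> it is 0.\<close>
    define f where "f c = b * h j0 c - a j0 * (int p * V c)" for c
    have "S \<omega> j0 = (\<Sum>c<1 * p. of_int (h j0 c) * \<omega> ^ c)"
      unfolding S_def fold_period h_def ..
    then have "(\<Sum>c<1 * p. of_int (f c) * \<omega> ^ c) = 0"
      using ab[OF j0] unfolding SV f_def
      by (simp add: sum_subtractf left_diff_distrib sum_distrib_left mult.assoc)
    note per = vanishing_sum_periodic[OF p power_0[symmetric] \<omega>(1,2) this]
    have f0: "f c = f (c mod 1)" if "c < p" for c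
      using that by (intro per) simp
    have fc: "f c = f c0" if "c < p" for c
      using f0[OF that] f0[OF c0(1)] by simp
    have "u j0 (c0 + p * d) = 0" if d: "d < p" for d
    proof -
      have "V (c0 + p * d) = 0" using Vper[OF bound[OF c0(1) d]] c0 by simp
      then show ?thesis
        using uV[OF j0 bound[OF c0(1) d]] u[OF j0 bound[OF c0(1) d]] by auto
    qed
    then have "f c0 = 0" by (simp add: f_def h_def c0)
    then have "f c = 0" if "c < p" for c using fc[OF that] by simp
    then have "0 = (\<Sum>c<p. f c)" by simp
    also have "\<dots> = b * (\<Sum>c<p. h j0 c) - a j0 * (\<Sum>c<p. int p * V c)"
      by (simp add: f_def sum_subtractf sum_distrib_left)
    also have "(\<Sum>c<p. h j0 c) = k"
      unfolding h_def sum_residues[symmetric] by (rule size[OF j0])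
    also have "(\<Sum>c<p. int p * V c) = m * k"
      unfolding sumV[symmetric] sum_residues using H by simp
    \<comment> \<open>Summing \<open>f\<close> over all cosets compares the block size
      \<open>k\<close> with the size \<open>m * k\<close> of the union.\<close>
    finally have "b = a j0 * m" using \<open>k > 1\<close> by (simp add: algebra_simps)
    then have "a j0 * (a j0 - b) = (a j0)\<^sup>2 * (1 - m)"
      by (simp add: power2_eq_square algebra_simps)
    also have "\<dots> \<le> 0" using J by (simp add: m_def mult_le_0_iff)
    finally show False using pos[OF j0] by simp
  qed
qed

section \<open>Characters of cyclic groups\<close>

lemma (in group) cyclic_group_powers:
  assumes "cyclic_group G" "finite (carrier G)"
  obtains g where "g \<in> carrier G" "ord g = Coset.order G"
    "bij_betw (\<lambda>i :: nat. g [^] i) {..<Coset.order G} (carrier G)"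
proof -
  obtain g where g: "g \<in> carrier G" "subgroup_generated G {g} = G"
    using assms(1) by (auto simp: cyclic_group_def)
  have gen: "generate G {g} = carrier G"
    using g carrier_subgroup_generated[of G "{g}"] by (simp add: Int_absorb1)
  then have ord: "ord g = Coset.order G"
    using generate_pow_card[OF g(1)] by (simp add: Coset.order_def)
  have pos: "Coset.order G > 0"
    using assms(2) by (simp add: order_gt_0_iff_finite)
  have "(\<lambda>i :: nat. g [^] i) ` {..<Coset.order G} = carrier G"
  proof -
    have "{0..Coset.order G - 1} = {..<Coset.order G}" using pos by auto
    then show ?thesis
      using ord_elems[OF assms(2) g(1)] generate_pow_on_finite_carrier[OF assms(2) g(1)] gen ord
      by auto
  qed
  then have "bij_betw (\<lambda>i :: nat. g [^] i) {..<Coset.order G} (carrier G)"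
    by (simp add: bij_betw_def eq_card_imp_inj_on Coset.order_def)
  then show ?thesis using that g(1) ord by blast
qed

lemma (in group) cyclic_character:
  fixes w :: complex
  assumes g: "g \<in> carrier G" "bij_betw (\<lambda>i :: nat. g [^] i) {..<Coset.order G} (carrier G)"
    and w: "w ^ Coset.order G = 1" and n: "Coset.order G > 0" and ord: "ord g = Coset.order G"
  obtains \<chi> where "\<And>i :: nat. \<chi> (g [^] i) = w ^ i"
    and "\<And>x y. x \<in> carrier G \<Longrightarrow> y \<in> carrier G \<Longrightarrow> \<chi> (x \<otimes> inv y) = \<chi> x * cnj (\<chi> y)"
proof -
  \<comment> \<open>The chosen exponent is determined modulo the group order only, which suffices
    since \<open>w\<close> to that order is 1.\<close>
  define \<chi> where "\<chi> x = w ^ (SOME i :: nat. g [^] i = x)" for x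
  have wmod: "w ^ i = w ^ (i mod Coset.order G)" for i
    using w by (metis mult_1 mult_div_mod_eq power_add power_mult power_one)
  have \<chi>: "\<chi> (g [^] i) = w ^ i" for i :: nat
  proof -
    define j where "j = (SOME j :: nat. g [^] j = g [^] i)"
    have "g [^] j = g [^] i"
      unfolding j_def by (rule someI[of _ i]) simp
    then have "g [^] int i = g [^] int j"
      by (simp only: int_pow_int)
    then have "int (Coset.order G) dvd int j - int i"
      using int_pow_eq[OF g(1)] ord by metis
    then have "j mod Coset.order G = i mod Coset.order G"
      by (metis mod_eq_dvd_iff of_nat_eq_iff zmod_int)
    then have "w ^ j = w ^ i" using wmod by metis
    then show ?thesis unfolding \<chi>_def j_def[symmetric] .
  qed
  have mult: "\<chi> (x \<otimes> y) = \<chi> x * \<chi> y" if "x \<in> carrier G" "y \<in> carrier G" for x y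
  proof -
    have "x \<in> (\<lambda>i :: nat. g [^] i) ` {..<Coset.order G}" "y \<in> (\<lambda>i :: nat. g [^] i) ` {..<Coset.order G}"
      using that g(2) by (simp_all add: bij_betw_def)
    then obtain i j :: nat where ij: "x = g [^] i" "y = g [^] j"
      by (elim imageE)
    have "x \<otimes> y = g [^] (i + j)" unfolding ij by (rule nat_pow_mult[OF g(1)])
    then show ?thesis by (simp only: ij \<chi> power_add)
  qed
  \<comment> \<open>Values on the unit circle turn inverses into conjugates.\<close>
  have "cmod w = 1"
    using w n power_eq_imp_eq_base[of "cmod w" "Coset.order G" 1] by (simp flip: norm_power)
  then have norm: "cmod (\<chi> x) = 1" for x by (simp add: \<chi>_def norm_power)
  have inv: "\<chi> (inv y) = cnj (\<chi> y)" if "y \<in> carrier G" for y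
  proof -
    have "\<chi> (inv y) * \<chi> y = 1"
      using mult[of "inv y" y] that \<chi>[of 0] by simp
    moreover have "cnj (\<chi> y) * \<chi> y = 1"
      using norm[of y] by (simp add: mult.commute flip: complex_norm_square)
    moreover have "\<chi> y \<noteq> 0" using norm[of y] by auto
    ultimately show ?thesis by (metis mult_right_cancel)
  qed
  show ?thesis using that[of \<chi>] \<chi> mult inv by simp
qed

lemma sum_mset_external_diff:
  fixes \<chi> :: "'a \<Rightarrow> complex"
  assumes "\<And>x y. x \<in> carrier G \<Longrightarrow> y \<in> carrier G \<Longrightarrow> \<chi> (x \<otimes>\<^bsub>G\<^esub> inv\<^bsub>G\<^esub> y) = \<chi> x * cnj (\<chi> y)"
    and "X \<subseteq> carrier G" "Y \<subseteq> carrier G"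
  shows "(\<Sum>x\<in>#external_diff G X Y. \<chi> x) = (\<Sum>x\<in>X. \<chi> x) * cnj (\<Sum>y\<in>Y. \<chi> y)"
proof -
  have "(\<Sum>x\<in>#external_diff G X Y. \<chi> x) = (\<Sum>(x, y)\<in>X \<times> Y. \<chi> (x \<otimes>\<^bsub>G\<^esub> inv\<^bsub>G\<^esub> y))"
    by (simp add: external_diff_def sum_unfold_sum_mset image_mset.compositionality o_def case_prod_beta)
  also have "\<dots> = (\<Sum>(x, y)\<in>X \<times> Y. \<chi> x * cnj (\<chi> y))"
    using assms by (intro sum.cong) auto
  finally show ?thesis
    by (simp add: sum_product sum.cartesian_product)
qed

text \<open>Summing \<open>\<chi>\<close> over both sides of the family equation factors each
  external difference; the missing index \<open>j\<close> becomes the subtracted term.\<close>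

lemma SEDF_character_sum:
  fixes \<chi> :: "'a \<Rightarrow> complex"
  assumes sedf: "SEDF G n m k l A" and j: "j \<in> {1..m}"
    and \<chi>: "\<And>x y. x \<in> carrier G \<Longrightarrow> y \<in> carrier G \<Longrightarrow> \<chi> (x \<otimes>\<^bsub>G\<^esub> inv\<^bsub>G\<^esub> y) = \<chi> x * cnj (\<chi> y)"
  shows "((\<Sum>i\<in>{1..m}. \<Sum>x\<in>A i. \<chi> x) - (\<Sum>x\<in>A j. \<chi> x)) * cnj (\<Sum>x\<in>A j. \<chi> x)
    = of_nat l * ((\<Sum>x\<in>carrier G. \<chi> x) - \<chi> \<one>\<^bsub>G\<^esub>)"
proof -
  have fin: "finite (carrier G)" and sub: "\<And>i. i \<in> {1..m} \<Longrightarrow> A i \<subseteq> carrier G"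
    and eq: "(\<Sum>i\<in>{1..m} - {j}. external_diff G (A i) (A j))
      = repeat_mset l (mset_set (carrier G - {\<one>\<^bsub>G\<^esub>}))"
    and "comm_group G"
    using sedf j by (auto simp: SEDF_def)
  then have one: "\<one>\<^bsub>G\<^esub> \<in> carrier G"
    by (simp add: comm_group_def group_def monoid.one_closed)
  have rep: "(\<Sum>x\<in>#repeat_mset c M. \<chi> x) = of_nat c * (\<Sum>x\<in>#M. \<chi> x)" for c M
    by (induction c) (auto simp: distrib_right sum_mset.distrib)
  have add: "(\<Sum>x\<in>#(\<Sum>i\<in>I. F i). \<chi> x) = (\<Sum>i\<in>I. \<Sum>x\<in>#F i. \<chi> x)" for I and F :: "nat \<Rightarrow> 'a multiset"
    by (induction I rule: infinite_finite_induct) auto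
  have "((\<Sum>i\<in>{1..m}. \<Sum>x\<in>A i. \<chi> x) - (\<Sum>x\<in>A j. \<chi> x)) * cnj (\<Sum>x\<in>A j. \<chi> x)
      = (\<Sum>i\<in>{1..m} - {j}. (\<Sum>x\<in>A i. \<chi> x) * cnj (\<Sum>x\<in>A j. \<chi> x))"
    using j by (simp add: sum_diff1 sum_distrib_right[symmetric])
  also have "\<dots> = (\<Sum>i\<in>{1..m} - {j}. \<Sum>x\<in>#external_diff G (A i) (A j). \<chi> x)"
    using sub j by (intro sum.cong refl sum_mset_external_diff[symmetric] \<chi>) auto
  also have "\<dots> = of_nat l * (\<Sum>x\<in>carrier G - {\<one>\<^bsub>G\<^esub>}. \<chi> x)"
    unfolding add[symmetric] eq
    by (simp add: rep sum_unfold_sum_mset)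
  finally show ?thesis using fin one by (simp add: sum_diff1)
qed

lemma sum_subset_reindex:
  fixes f :: "'a \<Rightarrow> 'b :: comm_ring_1"
  assumes e: "bij_betw e I X" and "finite X" "Y \<subseteq> X"
  shows "(\<Sum>y\<in>Y. f y) = (\<Sum>i\<in>I. of_int (of_bool (e i \<in> Y)) * f (e i))"
proof -
  have "(\<Sum>y\<in>Y. f y) = (\<Sum>x\<in>X. of_int (of_bool (x \<in> Y)) * f x)"
    using assms(2,3) by (intro sum.mono_neutral_cong_left) auto
  then show ?thesis
    using sum.reindex_bij_betw[OF e, of "\<lambda>x. of_int (of_bool (x \<in> Y)) * f x"] by simp
qed

theorem theorem3p7:
  fixes G :: "('a, 'b) monoid_scheme" and p m k l :: nat
  assumes "Factorial_Ring.prime p"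
    and "k > 1" and "m > 2" and "l \<ge> 1"
    and "group G" and "cyclic_group G" and "Coset.order G = p\<^sup>2"
  shows "\<nexists>A. SEDF G (p\<^sup>2) m k l A"
proof
  assume "\<exists>A. SEDF G (p\<^sup>2) m k l A"
  then obtain A where A: "SEDF G (p\<^sup>2) m k l A" ..
  interpret group G by fact
  have n: "Coset.order G = p * p" using assms(7) by (simp add: power2_eq_square)
  have fin: "finite (carrier G)" and disj: "disjoint_family_on A {1..m}"
    and sub: "\<And>j. j \<in> {1..m} \<Longrightarrow> A j \<subseteq> carrier G"
    and card: "\<And>j. j \<in> {1..m} \<Longrightarrow> card (A j) = k"
    using A by (auto simp: SEDF_def)
  have npos: "Coset.order G > 0" using fin by (simp add: order_gt_0_iff_finite)
  obtain g where g: "g \<in> carrier G" "ord g = Coset.order G"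
    and bij: "bij_betw (\<lambda>i :: nat. g [^]\<^bsub>G\<^esub> i) {..<Coset.order G} (carrier G)"
    using cyclic_group_powers[OF assms(6) fin] .
  define u :: "nat \<Rightarrow> nat \<Rightarrow> int" where "u j i = of_bool (g [^]\<^bsub>G\<^esub> i \<in> A j)" for j i
  note sum_A = sum_subset_reindex[OF bij fin sub, folded u_def, unfolded n]
  show False
  proof (rule no_sedf_indicator[of p "{1..m}" "int k" "int l" u])
    show "u j i \<in> {0, 1}" for j i by (simp add: u_def)
    show "(\<Sum>j\<in>{1..m}. u j i) \<in> {0, 1}" for i
    proof (cases "\<exists>j\<in>{1..m}. g [^]\<^bsub>G\<^esub> i \<in> A j")
      case True
      then obtain j where j: "j \<in> {1..m}" "g [^]\<^bsub>G\<^esub> i \<in> A j" by blast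
      then have "u j' i = of_bool (j' = j)" if "j' \<in> {1..m}" for j'
        using disj that unfolding u_def disjoint_family_on_def by fastforce
      then have "(\<Sum>j'\<in>{1..m}. u j' i) = 1" using j(1) by (simp add: of_bool_def)
      then show ?thesis by simp
    qed (auto simp: u_def)
    show "(\<Sum>i<p * p. u j i) = int k" if "j \<in> {1..m}" for j
      using sum_A[OF that, of "\<lambda>_. 1 :: int"] card[OF that] by simp
    fix w :: complex and j assume w: "w ^ (p * p) = 1" and j: "j \<in> {1..m}"
    obtain \<chi> where \<chi>: "\<And>i :: nat. \<chi> (g [^]\<^bsub>G\<^esub> i) = w ^ i"
      and hom: "\<And>x y. x \<in> carrier G \<Longrightarrow> y \<in> carrier G \<Longrightarrow>
        \<chi> (x \<otimes>\<^bsub>G\<^esub> inv\<^bsub>G\<^esub> y) = \<chi> x * cnj (\<chi> y)"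
      using cyclic_character[OF g(1) bij _ npos g(2)] w n by metis
    have "(\<Sum>x\<in>A i. \<chi> x) = (\<Sum>t<p * p. of_int (u i t) * w ^ t)" if "i \<in> {1..m}" for i
      using sum_A[OF that, of \<chi>] by (simp add: \<chi>)
    moreover have "(\<Sum>x\<in>carrier G. \<chi> x) = (\<Sum>t<p * p. w ^ t)"
      using sum.reindex_bij_betw[OF bij, of \<chi>] by (simp add: \<chi> n)
    moreover have "\<chi> \<one>\<^bsub>G\<^esub> = 1" using \<chi>[of 0] by simp
    ultimately show "((\<Sum>i\<in>{1..m}. \<Sum>t<p * p. of_int (u i t) * w ^ t)
        - (\<Sum>t<p * p. of_int (u j t) * w ^ t)) * cnj (\<Sum>t<p * p. of_int (u j t) * w ^ t)
      = of_int (int l) * ((\<Sum>t<p * p. w ^ t) - 1)"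
      using SEDF_character_sum[OF A j hom] j by (simp only: of_int_of_nat_eq cong: sum.cong)
  qed (use assms in auto)
qed

end
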